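(* Let $\mathcal{A}$ be a finite alphabet, let $\sigma : \mathcal{A} \to \mathcal{A}^*$ be a primitive morphism, and let $u \in \mathcal{A}^{\mathbb{N}}$ be such that $\sigma(u) = u$. Assume the following: (i) there exist a palindrome $p$ and, for every $a \in \mathcal{A}$, a palindrome $q_a$ such that $\sigma(a) = p q_a$ for every $a \in \mathcal{A}$ (or, alternatively, $\sigma(a) = q_a p$ for every $a \in \mathcal{A}$); (ii) the morphism $\sigma$ is uniform; let $l_p := |p|$, let $l_q := |q_a|$ for every $a \in \mathcal{A}$, and let $l := l_p + l_q$; (iii) for $a \neq b$ in $\mathcal{A}$, the words $q_a$ and $q_b$ have distinct first (and hence last) symbols. Then there exists $n_0 \in \mathbb{N} \setminus \{0\}$ such that for all $n \geq n_0$, $$\mathrm{pal}_u(n) = \sum_{k \in \mathcal{E}_n} \mathrm{pal}_u(k),$$ where $\mathcal{E}_n$ is the set of positive integers $s$ such that $n = s l + l_p - 2j$ for some integer $j$ with $0 \leq j \leq l-1$ (an empty sum being $0$).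
   Context: $\mathbb{N} = \{0,1,2,\ldots\}$. $\mathcal{A}^*$ is the free monoid of finite words (including the empty word) on $\mathcal{A}$, and $|w|$ is the length of the word $w$. A morphism on $\mathcal{A}$ is a monoid homomorphism $\mathcal{A}^* \to \mathcal{A}^*$, determined by its values on letters; it extends to infinite sequences by concatenating the images of the letters. It is uniform if the images of all letters have the same length. It is primitive if there exists $k \geq 1$ such that for each letter $a$, the word $\sigma^k(a)$ contains at least one occurrence of each letter of $\mathcal{A}$. A palindrome is a word equal to its reversal. A morphism $\sigma$ on $\mathcal{A}$ is in class P if there are a palindrome $p$ and palindromes $q_a$ ($a\in\mathcal{A}$) with $\sigma(a) = p q_a$ for every $a$ (or $\sigma(a) = q_a p$ for every $a$); the word $p$ can be empty, and if $p$ is not empty then some (or all) $q_a$ are allowed to be empty. So (i) says that $\sigma$ belongs to class P. $\mathrm{pal}_u(n)$ is the number of distinct palindromes of length $n$ that are factors (blocks of consecutive letters) of $u$.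
   Formalization: The formal statement additionally assumes that the alphabet has at least two letters or l is odd; over a one-letter alphabet with l even (e.g. σ(a)=aa, p empty) the claimed formula is false. *)

theory Defs
  imports "HOL-Library.Stream"
begin

definition morph :: "('a \<Rightarrow> 'a list) \<Rightarrow> 'a list \<Rightarrow> 'a list" where
  "morph \<sigma> w = concat (map \<sigma> w)"

text \<open>
  The library operation \<open>flat\<close> concatenates a stream of words correctly only when all of these
  words are nonempty. Primitive morphisms have no empty images, so for them this is the image of
  the sequence in the usual sense.
\<close>
definition morph_stream :: "('a \<Rightarrow> 'a list) \<Rightarrow> 'a stream \<Rightarrow> 'a stream" where
  "morph_stream \<sigma> u = flat (smap \<sigma> u)"

definition uniform_morphism :: "('a \<Rightarrow> 'a list) \<Rightarrow> bool" where
  "uniform_morphism \<sigma> \<longleftrightarrow> (\<forall>a b. length (\<sigma> a) = length (\<sigma> b))"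

definition primitive_morphism :: "('a \<Rightarrow> 'a list) \<Rightarrow> bool" where
  "primitive_morphism \<sigma> \<longleftrightarrow> (\<exists>k\<ge>1. \<forall>a b. b \<in> set ((morph \<sigma> ^^ k) [a]))"

definition palindrome :: "'a list \<Rightarrow> bool" where
  "palindrome w \<longleftrightarrow> rev w = w"

definition factor :: "'a list \<Rightarrow> 'a stream \<Rightarrow> bool" where
  "factor w u \<longleftrightarrow> (\<exists>x v. u = x @- (w @- v))"

definition pal :: "'a stream \<Rightarrow> nat \<Rightarrow> nat" where
  "pal u n = card {w. factor w u \<and> palindrome w \<and> length w = n}"

definition \<E> :: "nat \<Rightarrow> nat \<Rightarrow> nat \<Rightarrow> nat set" where
  "\<E> l lp n = {s. 0 < s \<and>
     (\<exists>j::int. 0 \<le> j \<and> j \<le> int l - 1 \<and> int n = int s * int l + int lp - 2 * j)}"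

end

theory Submission
  imports Defs
begin

text \<open>
  Write \<open>l\<close>-blocks as \<open>p q\<^sub>a\<close>. If \<open>v\<close> is a palindromic factor of \<open>u\<close> of length \<open>s\<close>, then
  \<open>p q\<^sub>a p q\<^sub>b p \<dots> q\<^sub>c p\<close>, the image of \<open>v\<close> closed by a further \<open>p\<close>, is again a palindromic factor,
  and so is what remains after removing \<open>j\<close> letters from both ends; its length is
  \<open>s l + |p| - 2 j\<close>. For large \<open>n\<close> the claim is that every palindromic factor of length \<open>n\<close> arises in
  this way from exactly one pair \<open>(s, v)\<close> with \<open>0 \<le> j < l\<close>. This bijection is
  \<open>card_pal_factors_acyclic\<close>.

  It rests on synchronization: a long factor of \<open>u\<close> determines the position of its \<open>l\<close>-blocks modulo
  \<open>l\<close>. Applied to two occurrences of one palindrome this gives injectivity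
  (\<open>occurrences_in_phase\<close>). For surjectivity it is applied to a palindrome and its own reversal: the
  reversal of a product of blocks is a product of blocks again, up to a shift by \<open>|p|\<close>, because
  \<open>p\<close> and all \<open>q\<^sub>a\<close> are palindromes. Hence block boundaries sit symmetrically about the centre
  (\<open>palindromes_in_phase\<close>), and the palindrome is a trimmed image of a palindrome.

  Synchronization has an elementary proof, since the last letter of a block determines the block
  (\<open>out_of_phase_step\<close>, \<open>synchronization\<close>). If two decompositions of a long factor into blocks are
  out of phase, then a block of one overlaps two consecutive blocks of the other; the second of
  these determines the overlapping block, which determines the first. So each letter of a long
  factor is a fixed function \<open>G\<close> of its successor, and by uniform recurrence this holds in all of
  \<open>u\<close>.

  There remains the case that \<open>u\<close> is cyclic in this sense (\<open>card_pal_factors_cyclic\<close>). As \<open>G\<close>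
  permutes the alphabet, \<open>u\<close> runs through all letters in a fixed cyclic order. With three or
  more letters there are no long palindromes at all. With two letters \<open>u\<close> alternates, which forces
  \<open>l\<close> to be odd and \<open>p\<close> to be empty. For odd \<open>l\<close> the index set has exactly one element
  (\<open>card_scales_odd\<close>), here of the same parity as \<open>n\<close>, and the number of palindromes depends only
  on that parity. Over a one-letter alphabet \<open>l\<close> is odd by assumption and every length has exactly
  one palindrome.

  If \<open>\<sigma>(a) = q\<^sub>a p\<close>, then \<open>u\<close> with an additional \<open>p\<close> in front is a product of blocks \<open>p q\<^sub>a\<close>.
  Both forms are therefore treated together, with an offset \<open>e\<close> for the letters missing from the
  first block.
\<close>

section \<open>The index sets\<close>

lemma scales_iff:
  assumes "l > 0"
  shows "s \<in> \<E> l lp n \<longleftrightarrow> 0 < s \<and> (\<exists>j<l. n + 2 * j = s * l + lp)"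
proof
  assume "s \<in> \<E> l lp n"
  then obtain j :: int where j: "0 < s" "0 \<le> j" "j \<le> int l - 1"
      "int n = int s * int l + int lp - 2 * j"
    unfolding \<E>_def by blast
  have "int (n + 2 * nat j) = int (s * l + lp)"
    using j by simp
  then have "n + 2 * nat j = s * l + lp"
    by (simp only: of_nat_eq_iff)
  moreover have "nat j < l"
    using j by linarith
  ultimately show "0 < s \<and> (\<exists>j<l. n + 2 * j = s * l + lp)"
    using j(1) by blast
next
  assume "0 < s \<and> (\<exists>j<l. n + 2 * j = s * l + lp)"
  then obtain j where j: "0 < s" "j < l" "n + 2 * j = s * l + lp" by blast
  have "int n + 2 * int j = int s * int l + int lp"
    using arg_cong[OF j(3), of int] by simp
  then have "int n = int s * int l + int lp - 2 * int j" by simp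
  moreover have "int j \<le> int l - 1" using j(2) by simp
  ultimately show "s \<in> \<E> l lp n"
    unfolding \<E>_def using j(1) by force
qed

lemma finite_scales:
  assumes "l > 0"
  shows "finite (\<E> l lp n)"
proof (rule finite_subset)
  show "\<E> l lp n \<subseteq> {..n + 2 * l}"
  proof
    fix s assume "s \<in> \<E> l lp n"
    then obtain j where j: "j < l" "n + 2 * j = s * l + lp"
      using scales_iff[OF assms] by blast
    have "s \<le> s * l" using assms by simp
    moreover have "s * l \<le> n + 2 * l" using j by linarith
    ultimately show "s \<in> {..n + 2 * l}" by (simp only: atMost_iff)
  qed
qed simp

text \<open>
  The products \<open>s l\<close> have to lie in a window of \<open>2 l - 1\<close> consecutive integers and to have the parity of
  \<open>n - lp\<close>. As \<open>l\<close> is odd, these products alternate in parity, so that the admissible ones are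
  \<open>2 l\<close> apart.
\<close>
lemma card_scales_odd:
  assumes "odd l" "n > lp"
  shows "card (\<E> l lp n) = 1"
proof -
  have l: "l > 0" using assms(1) by (cases l) auto
  \<comment> \<open>\<open>s0\<close> is \<open>(n - lp) / l\<close> rounded up, the least value in the window\<close>
  define s0 where "s0 = (n - lp + l - 1) div l"
  have s0: "n - lp \<le> s0 * l" "s0 * l \<le> n - lp + l - 1"
  proof -
    have "n - lp + l - 1 = s0 * l + (n - lp + l - 1) mod l"
      unfolding s0_def by simp
    moreover have "(n - lp + l - 1) mod l < l" using l by simp
    ultimately show "n - lp \<le> s0 * l" "s0 * l \<le> n - lp + l - 1"
      using assms(2) by linarith+
  qed
  define s where "s = (if even (s0 * l + n + lp) then s0 else Suc s0)"
  have par: "even (s * l + n + lp)"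
    unfolding s_def using assms(1) by auto
  have lo: "n \<le> s * l + lp" using s0(1) assms(2) by (auto simp: s_def)
  have hi: "s * l + lp \<le> n + 2 * l - 1" using s0(2) assms(2) l by (auto simp: s_def)
  have "even (s * l + lp - n)"
    using par lo by (simp add: even_diff_nat) presburger
  then obtain j where j: "s * l + lp - n = 2 * j" by (elim evenE)
  have ex: "s \<in> \<E> l lp n"
  proof -
    have "s > 0" using lo assms(2) by (cases s) auto
    moreover have "n + 2 * j = s * l + lp" using j lo by linarith
    moreover have "j < l" using j hi l lo by linarith
    ultimately show ?thesis using scales_iff[OF l] by blast
  qed
  have uniq: "s1 = s2" if mem: "s1 \<in> \<E> l lp n" "s2 \<in> \<E> l lp n" and le: "s1 \<le> s2" for s1 s2
  proof -
    obtain j1 j2 where j: "j1 < l" "n + 2 * j1 = s1 * l + lp" "j2 < l" "n + 2 * j2 = s2 * l + lp"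
      using mem(1)[unfolded scales_iff[OF l]] mem(2)[unfolded scales_iff[OF l]] by blast
    obtain d where d: "s2 = s1 + d" using le le_Suc_ex by blast
    have dl: "d * l + 2 * j1 = 2 * j2" using j d by (simp add: add_mult_distrib)
    then have "even (d * l)" by presburger
    then have "even d" using assms(1) by simp
    moreover have "d < 2"
    proof (rule ccontr)
      assume "\<not> d < 2"
      then have "2 * l \<le> d * l" by (intro mult_le_mono1) simp
      then show False using dl j by linarith
    qed
    ultimately show ?thesis using d by (cases d) auto
  qed
  have "\<E> l lp n = {s}"
  proof (intro equalityI subsetI)
    fix s' assume "s' \<in> \<E> l lp n"
    then show "s' \<in> {s}" using uniq[OF _ ex] uniq[OF ex] nat_le_linear[of s s'] by auto
  qed (use ex in simp)
  then show ?thesis by simp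
qed

section \<open>Factors as windows of a sequence\<close>

definition pal_factors :: "(nat \<Rightarrow> 'a) \<Rightarrow> nat \<Rightarrow> 'a list set" where
  "pal_factors U n = {w. (\<exists>i. w = map U [i..<i + n]) \<and> palindrome w}"

lemma finite_pal_factors:
  fixes U :: "nat \<Rightarrow> 'a::finite"
  shows "finite (pal_factors U n)"
  by (rule finite_subset[OF _ finite_lists_length_eq[of UNIV n]]) (auto simp: pal_factors_def)

lemma factor_iff_window:
  "factor w u \<longleftrightarrow> (\<exists>i. w = map (snth u) [i..<i + length w])"
proof
  assume "factor w u"
  then obtain x v where u: "u = x @- (w @- v)" unfolding factor_def by blast
  have "w = map (snth u) [length x..<length x + length w]"
    by (rule nth_equalityI) (auto simp: u)
  then show "\<exists>i. w = map (snth u) [i..<i + length w]" by blast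
next
  assume "\<exists>i. w = map (snth u) [i..<i + length w]"
  then obtain i where i: "w = map (snth u) [i..<i + length w]" by blast
  have "w = stake (length w) (sdrop i u)"
    by (subst i) (rule nth_equalityI, auto simp: sdrop_snth add.commute)
  then have "w @- sdrop (length w) (sdrop i u) = sdrop i u"
    using stake_sdrop by metis
  then have "u = stake i u @- (w @- sdrop (length w) (sdrop i u))"
    using stake_sdrop by metis
  then show "factor w u" unfolding factor_def by blast
qed

lemma pal_eq_card: "pal u n = card (pal_factors (snth u) n)"
proof -
  have "{w. factor w u \<and> palindrome w \<and> length w = n} = pal_factors (snth u) n"
    unfolding pal_factors_def factor_iff_window by auto
  then show ?thesis unfolding pal_def by simp
qed

lemma palindrome_window_iff:
  "palindrome (map U [i..<i + n]) \<longleftrightarrow> (\<forall>t<n. U (i + t) = U (i + (n - 1 - t)))"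
  unfolding palindrome_def list_eq_iff_nth_eq by (auto simp: rev_nth)

section \<open>Uniform morphisms and recurrence\<close>

lemma length_morph_pow:
  assumes "\<And>a. length (\<sigma> a) = l"
  shows "length ((morph \<sigma> ^^ k) w) = l ^ k * length w"
proof (induction k)
  case (Suc k)
  have "length (morph \<sigma> v) = l * length v" for v
    unfolding morph_def using assms by (induction v) auto
  then show ?case using Suc by simp
qed simp

lemma snth_fixed_point:
  assumes "\<And>a. length (\<sigma> a) = l" "l > 0" "j < l"
    and "morph_stream \<sigma> u = u"
  shows "u !! (m * l + j) = \<sigma> (u !! m) ! j"
proof -
  have ne: "\<sigma> a \<noteq> []" for a using assms(1)[of a] assms(2) by auto
  have "flat (smap \<sigma> v) !! (m * l + j) = \<sigma> (v !! m) ! j" for v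
  proof (induction m arbitrary: v)
    case 0
    have "flat (smap \<sigma> v) = \<sigma> (shd v) @- flat (smap \<sigma> (stl v))"
      by (metis flat_Stream ne smap_simps(1) smap_simps(2) stream.collapse)
    then show ?case using assms by simp
  next
    case (Suc m)
    have "flat (smap \<sigma> v) = \<sigma> (shd v) @- flat (smap \<sigma> (stl v))"
      by (metis flat_Stream ne smap_simps(1) smap_simps(2) stream.collapse)
    then show ?case using assms Suc[of "stl v"] by (simp add: shift_snth_ge)
  qed
  then show ?thesis using assms(4) unfolding morph_stream_def by metis
qed

lemma morph_pow_window:
  assumes len: "\<And>a. length (\<sigma> a) = l" and "l > 0"
    and par: "\<And>m j. j < l \<Longrightarrow> U (m * l + j) = \<sigma> (U m) ! j"
  shows "(morph \<sigma> ^^ k) (map U [a..<b]) = map U [a * l ^ k..<b * l ^ k]"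
proof (induction k arbitrary: a b)
  case (Suc k)
  have img: "\<sigma> (U m) = map U [m * l..<Suc m * l]" for m
    by (rule nth_equalityI) (auto simp: len par)
  have "morph \<sigma> (map U [a..<b]) = map U [a * l..<b * l]" for a b
  proof (induction b)
    case (Suc b)
    show ?case
    proof (cases "a \<le> b")
      case True
      have "morph \<sigma> (map U [a..<Suc b]) = map U ([a * l..<b * l] @ [b * l..<Suc b * l])"
        using True Suc img[of b] unfolding morph_def by simp
      also have "[a * l..<b * l] @ [b * l..<Suc b * l] = [a * l..<Suc b * l]"
        using True upt_add_eq_append[of "a * l" "b * l" l] by (simp add: add.commute)
      finally show ?thesis .
    next
      case False
      then have "Suc b * l \<le> a * l" by (intro mult_le_mono1) simp
      then show ?thesis using False by (simp add: morph_def)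
    qed
  qed (simp add: morph_def)
  then show ?case using Suc by (simp add: algebra_simps)
qed simp

text \<open>
  The prefix of length \<open>N\<close> lies inside \<open>\<sigma>\<^sup>N(u\<^sub>0)\<close>, and by primitivity \<open>\<sigma>\<^sup>k\<close> of any letter contains
  \<open>u\<^sub>0\<close>. Hence the prefix occurs in each of the blocks \<open>\<sigma>\<^bsup>k+N\<^esup>(u\<^sub>m)\<close> that make up the sequence.
\<close>
lemma prefix_uniformly_recurrent:
  fixes \<sigma> :: "'a \<Rightarrow> 'a list"
  assumes len: "\<And>a. length (\<sigma> a) = l" and l: "l \<ge> 2"
    and par: "\<And>m j. j < l \<Longrightarrow> U (m * l + j) = \<sigma> (U m) ! j"
    and prim: "primitive_morphism \<sigma>"
  shows "\<exists>K. \<forall>T. \<exists>i\<ge>T. i + N \<le> T + K \<and> (\<forall>j<N. U (i + j) = U j)"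
proof -
  have l0: "l > 0" using l by simp
  note win = morph_pow_window[of \<sigma> l U, OF len l0 par]
  obtain k where k: "\<And>a b. b \<in> set ((morph \<sigma> ^^ k) [a])"
    using prim unfolding primitive_morphism_def by blast
  have Nl: "N \<le> l ^ N"
    using l by (meson le_trans less_exp less_or_eq_imp_le power_mono zero_le)
  define B where "B = l ^ k * l ^ N"
  have B: "B > 0" unfolding B_def using l0 by simp
  have "\<exists>i\<ge>T. i + N \<le> T + 2 * B \<and> (\<forall>j<N. U (i + j) = U j)" for T
  proof -
    define m where "m = Suc (T div B)"
    have mB: "T \<le> m * B" "m * B \<le> T + B"
      using B div_mult_mod_eq[of T B] mod_less_divisor[OF B, of T] unfolding m_def
      by (simp_all, linarith+)
    have "U 0 \<in> set (map U [m * l ^ k..<Suc m * l ^ k])"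
      using k[of "U 0" "U m"] win[of k m "Suc m"] by simp
    then obtain i where i: "m * l ^ k \<le> i" "Suc i \<le> Suc m * l ^ k" "U i = U 0"
      by auto
    have eq: "map U [i * l ^ N..<Suc i * l ^ N] = map U [0 * l ^ N..<Suc 0 * l ^ N]"
      using win[of N i "Suc i"] win[of N 0 "Suc 0"] i(3) by simp
    have "U (i * l ^ N + j) = U j" if "j < N" for j
      using arg_cong[OF eq, of "\<lambda>w. w ! j"] that Nl by simp
    moreover have "T \<le> i * l ^ N"
    proof -
      have "m * B = m * l ^ k * l ^ N" by (simp add: B_def)
      also have "\<dots> \<le> i * l ^ N" using i(1) by (rule mult_le_mono1)
      finally show ?thesis using mB(1) by linarith
    qed
    moreover have "i * l ^ N + N \<le> T + 2 * B"
    proof -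
      have "i * l ^ N + N \<le> Suc i * l ^ N" using Nl by simp
      also have "\<dots> \<le> Suc m * l ^ k * l ^ N" using i(2) by (rule mult_le_mono1)
      also have "\<dots> = m * B + B" by (simp add: B_def algebra_simps)
      finally show ?thesis using mB by simp
    qed
    ultimately show ?thesis by blast
  qed
  then show ?thesis by blast
qed

section \<open>Marked sequences and synchronization\<close>

text \<open>
  A sequence \<open>U\<close> that is a product of \<open>l\<close>-blocks, the block with index \<open>m\<close> being the image of \<open>U m\<close>;
  the first \<open>e\<close> letters of the block with index \<open>0\<close> are cut off. Here \<open>f j a\<close> stands for the letter in
  column \<open>j\<close> of \<open>p q\<^sub>a\<close>. The two reflection laws say that \<open>p\<close> and \<open>q\<^sub>a\<close> are palindromes; they amount to
  the symmetry \<open>j \<mapsto> lp - 1 - j\<close> of columns modulo \<open>l\<close>. Naming only columns frees the argument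
  from the distinction between the two forms of the morphism.
\<close>
locale marked_sequence =
  fixes U :: "nat \<Rightarrow> 'a::finite" and f :: "nat \<Rightarrow> 'a \<Rightarrow> 'a" and l lp e :: nat
  assumes lp_less: "lp < l" and e_le: "e \<le> lp"
    and parse: "\<And>m j. j < l \<Longrightarrow> e \<le> m * l + j \<Longrightarrow> U (m * l + j - e) = f j (U m)"
    and column_const: "\<And>j a b. j < lp \<Longrightarrow> f j a = f j b"
    and column_reflect_p: "\<And>j a. j < lp \<Longrightarrow> f (lp - 1 - j) a = f j a"
    and column_reflect_q: "\<And>j a. lp \<le> j \<Longrightarrow> j < l \<Longrightarrow> f (l + lp - 1 - j) a = f j a"
    and inj_last: "inj (f (l - 1))"
    and recurrent: "\<And>N. \<exists>K. \<forall>T. \<exists>i\<ge>T. i + N \<le> T + K \<and> (\<forall>j<N. U (i + j) = U j)"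
    and all_letters: "range U = UNIV"
begin

text \<open>
  Each letter is determined by its successor. Since all letters occur, this means that \<open>U\<close> runs through
  the alphabet in a fixed cyclic order.
\<close>
definition cyclic :: bool where
  "cyclic \<longleftrightarrow> (\<exists>G. \<forall>t. U t = G (U (Suc t)))"

lemma l_pos: "l > 0" using lp_less by simp

lemma inj_first: "inj (f lp)"
proof -
  have "f lp = f (l - 1)"
    using column_reflect_q[of "l - 1"] lp_less by (intro ext) simp
  then show ?thesis using inj_last by simp
qed

lemma parse_at: "U t = f ((t + e) mod l) (U ((t + e) div l))"
  using parse[of "(t + e) mod l" "(t + e) div l"] l_pos by simp

text \<open>
  The image under the morphism of a two-sided infinite sequence of letters, with a block boundary
  at the origin. Two-sided sequences are convenient because reversing a sequence yields negative
  block indices.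
\<close>
definition image_seq :: "(int \<Rightarrow> 'a) \<Rightarrow> int \<Rightarrow> 'a" where
  "image_seq Y \<tau> = f (nat (\<tau> mod int l)) (Y (\<tau> div int l))"

lemma image_seq_column: "c < l \<Longrightarrow> image_seq Y (k * int l + int c) = f c (Y k)"
  using l_pos by (simp add: image_seq_def)

text \<open>
  The block of \<open>X\<close> that straddles the boundary between the blocks \<open>\<mu>\<close> and \<open>\<mu> + 1\<close> of \<open>Y\<close> has
  its last letter inside block \<open>\<mu> + 1\<close>, so \<open>Y (\<mu> + 1)\<close> determines that block; the block in turn covers
  the last letter of block \<open>\<mu>\<close> and so determines \<open>Y \<mu>\<close>. The function \<open>G\<close> is chosen before \<open>Y\<close>, \<open>X\<close> and
  \<open>\<mu>\<close> because it has to be the same at all places.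
\<close>
lemma out_of_phase_step:
  assumes "\<not> int l dvd \<delta>"
  shows "\<exists>G. \<forall>Y X \<mu>. (\<forall>\<tau>\<in>{\<mu> * int l..<(\<mu> + 2) * int l}. image_seq Y \<tau> = image_seq X (\<tau> + \<delta>))
    \<longrightarrow> Y \<mu> = G (Y (\<mu> + 1))"
proof -
  \<comment> \<open>\<open>r\<close> is the column of \<open>Y\<close> at which the blocks of \<open>X\<close> begin\<close>
  define r where "r = nat ((- \<delta>) mod int l)"
  define \<nu> where "\<nu> = (- \<delta>) div int l"
  have l0: "int l > 0" using l_pos by simp
  have r: "int r = (- \<delta>) mod int l" unfolding r_def using l0 by simp
  have rl: "r < l" using r l0 pos_mod_bound[OF l0, of "- \<delta>"] by linarith
  have r0: "0 < r"
  proof (rule ccontr)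
    assume "\<not> 0 < r"
    then have "(- \<delta>) mod int l = 0" using r by simp
    then have "int l dvd - \<delta>" by presburger
    then show False using assms by simp
  qed
  have \<delta>: "\<delta> = - (\<nu> * int l) - int r"
    using div_mult_mod_eq[of "- \<delta>" "int l"] unfolding \<nu>_def r by linarith
  let ?G = "\<lambda>y. inv (f (l - 1)) (f (l - 1 - r) (inv (f (l - 1)) (f (r - 1) y)))"
  have "Y \<mu> = ?G (Y (\<mu> + 1))"
    if win: "\<forall>\<tau>\<in>{\<mu> * int l..<(\<mu> + 2) * int l}. image_seq Y \<tau> = image_seq X (\<tau> + \<delta>)" for Y X \<mu>
  proof -
    have "\<mu> * int l + int (l - 1) + \<delta> = (\<mu> - \<nu>) * int l + int (l - 1 - r)"
      using rl l_pos by (simp add: \<delta> algebra_simps of_nat_diff)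
    moreover have "\<mu> * int l + int (l - 1) \<in> {\<mu> * int l..<(\<mu> + 2) * int l}"
      using l_pos by (simp add: distrib_right)
    ultimately have "f (l - 1) (Y \<mu>) = f (l - 1 - r) (X (\<mu> - \<nu>))"
      using win image_seq_column[of "l - 1" Y \<mu>] image_seq_column[of "l - 1 - r" X "\<mu> - \<nu>"] l_pos
      by simp
    moreover have "f (r - 1) (Y (\<mu> + 1)) = f (l - 1) (X (\<mu> - \<nu>))"
    proof -
      have "(\<mu> + 1) * int l + int (r - 1) + \<delta> = (\<mu> - \<nu>) * int l + int (l - 1)"
        using r0 l_pos by (simp add: \<delta> algebra_simps of_nat_diff)
      moreover have "(\<mu> + 1) * int l + int (r - 1) \<in> {\<mu> * int l..<(\<mu> + 2) * int l}"
        using rl l_pos by (simp add: distrib_right)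
      ultimately show ?thesis
        using win image_seq_column[of "r - 1" Y "\<mu> + 1"] image_seq_column[of "l - 1" X "\<mu> - \<nu>"] rl l_pos
        by simp
    qed
    ultimately show ?thesis using inj_last by (metis inv_f_f)
  qed
  then show ?thesis by (intro exI[of _ ?G]) blast
qed

text \<open>
  There are only finitely many two-letter factors, so some prefix contains all of them, and this prefix
  is uniformly recurrent.
\<close>
lemma two_letter_factors_in_windows:
  "\<exists>K. \<forall>T t. \<exists>i\<ge>T. Suc i < T + K \<and> U i = U t \<and> U (Suc i) = U (Suc t)"
proof -
  let ?g = "\<lambda>t. (U t, U (Suc t))"
  obtain C where C: "finite C" "range ?g = ?g ` C"
    using finite_subset_image[of "range ?g" ?g UNIV] by auto
  define N where "N = Max (insert 0 C) + 2"
  have N: "Suc c < N" if "c \<in> C" for c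
  proof -
    have "c \<le> Max (insert 0 C)" using C(1) that by (intro Max_ge) simp_all
    then show ?thesis unfolding N_def by linarith
  qed
  obtain K where K: "\<And>T. \<exists>i\<ge>T. i + N \<le> T + K \<and> (\<forall>j<N. U (i + j) = U j)"
    using recurrent[of N] by blast
  have "\<exists>i\<ge>T. Suc i < T + K \<and> U i = U t \<and> U (Suc i) = U (Suc t)" for T t
  proof -
    obtain c where c: "c \<in> C" "?g t = ?g c" using C(2) by blast
    obtain i where i: "i \<ge> T" "i + N \<le> T + K" "\<And>j. j < N \<Longrightarrow> U (i + j) = U j"
      using K by blast
    have "U (i + c) = U c" "U (i + Suc c) = U (Suc c)"
      using N[OF c(1)] i(3)[of c] i(3)[of "Suc c"] by simp_all
    then have "i + c \<ge> T \<and> Suc (i + c) < T + K \<and> U (i + c) = U t \<and> U (Suc (i + c)) = U (Suc t)"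
      using c(2) i(1,2) N[OF c(1)] by simp
    then show ?thesis by blast
  qed
  then show ?thesis by blast
qed

text \<open>
  The letters whose blocks lie inside a long window form a word with every two-letter factor of \<open>U\<close>.
  If a second decomposition is out of phase there, the rule \<open>Y \<mu> = G (Y (\<mu> + 1))\<close> on the window
  extends to the whole of \<open>U\<close>. The competing sequence \<open>X\<close> is
  arbitrary; below it is \<open>U\<close> itself or the reversal of \<open>U\<close>.
\<close>
lemma synchronization:
  assumes "\<not> cyclic"
  shows "\<exists>L. \<forall>\<alpha>\<ge>0. \<forall>\<delta> X.
    (\<forall>\<tau>\<in>{\<alpha>..<\<alpha> + int L}. image_seq (\<lambda>k. U (nat k)) \<tau> = image_seq X (\<tau> + \<delta>)) \<longrightarrow> int l dvd \<delta>"
proof -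
  obtain K where K: "\<And>T t. \<exists>i\<ge>T. Suc i < T + K \<and> U i = U t \<and> U (Suc i) = U (Suc t)"
    using two_letter_factors_in_windows by blast
  \<comment> \<open>room for \<open>K\<close> complete blocks after the first block boundary in the window\<close>
  define L where "L = (K + 2) * l"
  have "int l dvd \<delta>" if \<alpha>: "0 \<le> \<alpha>"
    and win: "\<forall>\<tau>\<in>{\<alpha>..<\<alpha> + int L}. image_seq (\<lambda>k. U (nat k)) \<tau> = image_seq X (\<tau> + \<delta>)" for \<alpha> \<delta> X
  proof (rule ccontr)
    assume nd: "\<not> int l dvd \<delta>"
    obtain G where G: "\<forall>Y X \<mu>. (\<forall>\<tau>\<in>{\<mu> * int l..<(\<mu> + 2) * int l}. image_seq Y \<tau> = image_seq X (\<tau> + \<delta>))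
        \<longrightarrow> Y \<mu> = G (Y (\<mu> + 1))"
      using out_of_phase_step[OF nd] by (elim exE)
    define a where "a = nat \<alpha>"
    have a: "\<alpha> = int a" using \<alpha> unfolding a_def by simp
    define T where "T = Suc (a div l)"
    have T: "a \<le> T * l" "T * l \<le> a + l"
      using div_mult_mod_eq[of a l] mod_less_divisor[OF l_pos, of a] unfolding T_def
      by (simp_all, linarith+)
    have "U t = G (U (Suc t))" for t
    proof -
      obtain i where i: "i \<ge> T" "Suc i < T + K" "U i = U t" "U (Suc i) = U (Suc t)"
        using K by blast
      have "a \<le> i * l" using mult_le_mono1[OF i(1), of l] T(1) by linarith
      then have lo: "\<alpha> \<le> int i * int l"
        unfolding a by (simp flip: of_nat_mult)
      have "(i + 2) * l \<le> (T + K + 1) * l" using i(2) by (intro mult_le_mono1) simp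
      also have "\<dots> = T * l + (K + 1) * l" by (simp add: algebra_simps)
      also have "\<dots> \<le> a + L" using T(2) by (simp add: L_def algebra_simps)
      finally have "int ((i + 2) * l) \<le> int (a + L)" by (simp only: of_nat_le_iff)
      then have hi: "(int i + 2) * int l \<le> \<alpha> + int L" unfolding a by (simp add: distrib_right)
      have "\<forall>\<tau>\<in>{int i * int l..<(int i + 2) * int l}.
          image_seq (\<lambda>k. U (nat k)) \<tau> = image_seq X (\<tau> + \<delta>)"
        using win lo hi by fastforce
      then have "U (nat (int i)) = G (U (nat (int i + 1)))"
        by (rule G[THEN spec[of _ "\<lambda>k. U (nat k)"], THEN spec[of _ X], THEN spec[of _ "int i"], THEN mp])
      then show ?thesis using i(3,4) by (simp add: nat_add_distrib)
    qed
    then show False using assms unfolding cyclic_def by blast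
  qed
  then show ?thesis by (intro exI[of _ L] allI impI)
qed

lemma image_seq_parse: "image_seq (\<lambda>k. U (nat k)) (int t + int e) = U t"
proof -
  have "int t + int e = int ((t + e) div l) * int l + int ((t + e) mod l)"
    by (simp only: flip: of_nat_mult of_nat_add) (simp only: div_mult_mod_eq)
  then show ?thesis
    using image_seq_column[of "(t + e) mod l"] l_pos parse_at[of t] by simp
qed

text \<open>
  The reversal of \<open>U\<close> is an image under the same morphism: column \<open>c\<close> of block \<open>m\<close> goes to column
  \<open>lp - 1 - c\<close> modulo \<open>l\<close>, that is, within \<open>p\<close> or within some \<open>q\<^sub>a\<close>. Blocks are
  renumbered by \<open>m \<mapsto> - 1 - m\<close>, which is correct for the parts \<open>q\<^sub>a\<close>; the reflected copy of a
  \<open>p\<close> falls into a neighbouring block, but its columns carry no information about the letter.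
\<close>
lemma image_seq_parse_reflected:
  "image_seq (\<lambda>k. U (nat (- 1 - k))) (int lp - 1 - (int t + int e)) = U t"
proof -
  define m c where "m = (t + e) div l" and "c = (t + e) mod l"
  have c: "c < l" and tc: "t + e = m * l + c"
    unfolding m_def c_def using l_pos by simp_all
  have tc': "int t + int e = int m * int l + int c"
    using arg_cong[OF tc, of int] by simp
  have ut: "U t = f c (U m)" using parse_at[of t] unfolding m_def c_def .
  show ?thesis
  proof (cases "c < lp")
    case True
    have "int lp - 1 - (int t + int e) = (- int m) * int l + int (lp - 1 - c)"
      using True tc' by (simp add: of_nat_diff)
    moreover have "lp - 1 - c < l" using lp_less by linarith
    ultimately have "image_seq (\<lambda>k. U (nat (- 1 - k))) (int lp - 1 - (int t + int e))
        = f (lp - 1 - c) (U (nat (- 1 - (- int m))))"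
      by (simp only: image_seq_column)
    then show ?thesis
      unfolding ut using True column_reflect_p column_const by metis
  next
    case False
    have "int lp - 1 - (int t + int e) = (- int m - 1) * int l + int (l + lp - 1 - c)"
      using False c tc' by (simp add: of_nat_diff algebra_simps)
    moreover have "l + lp - 1 - c < l" using False c by linarith
    ultimately have "image_seq (\<lambda>k. U (nat (- 1 - k))) (int lp - 1 - (int t + int e))
        = f (l + lp - 1 - c) (U m)"
      by (simp only: image_seq_column) simp
    then show ?thesis unfolding ut using False c column_reflect_q[of c] by simp
  qed
qed

lemma occurrences_in_phase:
  assumes "\<not> cyclic"
  shows "\<exists>L. \<forall>a b. (\<forall>t<L. U (a + t) = U (b + t)) \<longrightarrow> (a + e) mod l = (b + e) mod l"
proof -
  obtain L where L: "\<forall>\<alpha>\<ge>0. \<forall>\<delta> X.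
    (\<forall>\<tau>\<in>{\<alpha>..<\<alpha> + int L}. image_seq (\<lambda>k. U (nat k)) \<tau> = image_seq X (\<tau> + \<delta>)) \<longrightarrow> int l dvd \<delta>"
    using synchronization[OF assms] by (elim exE)
  have "(a + e) mod l = (b + e) mod l" if eq: "\<forall>t<L. U (a + t) = U (b + t)" for a b
  proof -
    have "int l dvd int b - int a"
    proof (rule L[rule_format, where \<alpha> = "int (a + e)" and X = "\<lambda>k. U (nat k)"])
      fix \<tau> assume \<tau>: "\<tau> \<in> {int (a + e)..<int (a + e) + int L}"
      define s where "s = nat (\<tau> - int (a + e))"
      have s: "s < L" "\<tau> = int (a + s) + int e" "\<tau> + (int b - int a) = int (b + s) + int e"
        using \<tau> unfolding s_def by auto
      show "image_seq (\<lambda>k. U (nat k)) \<tau> = image_seq (\<lambda>k. U (nat k)) (\<tau> + (int b - int a))"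
        unfolding s(3) unfolding s(2) image_seq_parse using eq s(1) by blast
    qed simp
    then have "int l dvd int (b + e) - int (a + e)" by simp
    then have "int (b + e) mod int l = int (a + e) mod int l"
      by (simp only: mod_eq_dvd_iff)
    then show ?thesis by (metis of_nat_eq_iff of_nat_mod)
  qed
  then show ?thesis by blast
qed

text \<open>
  A palindromic window coincides with its reversal, and block boundaries of the reversal are those of
  \<open>U\<close> reflected and shifted by \<open>lp\<close>. Synchronization makes the two families agree modulo \<open>l\<close>.
\<close>
lemma palindromes_in_phase:
  assumes "\<not> cyclic"
  shows "\<exists>L. \<forall>a. \<forall>n\<ge>L. palindrome (map U [a..<a + n]) \<longrightarrow>
      int l dvd 2 * (int a + int e) + int n - int lp"
proof -
  obtain L where L: "\<forall>\<alpha>\<ge>0. \<forall>\<delta> X.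
    (\<forall>\<tau>\<in>{\<alpha>..<\<alpha> + int L}. image_seq (\<lambda>k. U (nat k)) \<tau> = image_seq X (\<tau> + \<delta>)) \<longrightarrow> int l dvd \<delta>"
    using synchronization[OF assms] by (elim exE)
  have "int l dvd 2 * (int a + int e) + int n - int lp"
    if n: "n \<ge> L" and pal: "palindrome (map U [a..<a + n])" for a n
  proof -
    define \<delta> where "\<delta> = int lp - (2 * (int a + int e) + int n)"
    have "int l dvd \<delta>"
    proof (rule L[rule_format, where \<alpha> = "int (a + e)" and X = "\<lambda>k. U (nat (- 1 - k))"])
      fix \<tau> assume \<tau>: "\<tau> \<in> {int (a + e)..<int (a + e) + int L}"
      define s where "s = nat (\<tau> - int (a + e))"
      have s: "s < n" "\<tau> = int (a + s) + int e"
          "\<tau> + \<delta> = int lp - 1 - (int (a + (n - 1 - s)) + int e)"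
        using \<tau> n unfolding s_def \<delta>_def by auto
      show "image_seq (\<lambda>k. U (nat k)) \<tau> = image_seq (\<lambda>k. U (nat (- 1 - k))) (\<tau> + \<delta>)"
        unfolding s(3) unfolding s(2) image_seq_parse image_seq_parse_reflected
        using pal s(1) unfolding palindrome_window_iff by blast
    qed simp
    then show ?thesis unfolding \<delta>_def by (metis dvd_minus_iff minus_diff_eq)
  qed
  then show ?thesis by blast
qed

section \<open>Inflated palindromes\<close>

text \<open>
  The word of length \<open>n\<close> that begins at column \<open>j\<close> of the image of \<open>v\<close> followed by \<open>p\<close>. On the final \<open>p\<close>
  the index into \<open>v\<close> is past the end; this is harmless because the columns of \<open>p\<close> do not depend
  on the letter. All uses have \<open>n + 2 * j = length v * l + lp\<close>, so that \<open>j\<close> letters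
  are removed from both ends.
\<close>
definition inflate :: "nat \<Rightarrow> nat \<Rightarrow> 'a list \<Rightarrow> 'a list" where
  "inflate n j v = map (\<lambda>t. f ((j + t) mod l) (v ! ((j + t) div l))) [0..<n]"

lemma inflate_window:
  assumes "n + 2 * j = s * l + lp" and "e \<le> m * l + j"
  shows "inflate n j (map U [m..<m + s]) = map U [m * l + j - e..<m * l + j - e + n]"
proof (rule nth_equalityI)
  fix t assume "t < length (inflate n j (map U [m..<m + s]))"
  then have t: "t < n" by (simp add: inflate_def)
  define k c where "k = (j + t) div l" and "c = (j + t) mod l"
  have c: "c < l" and kc: "j + t = k * l + c"
    unfolding k_def c_def using l_pos by simp_all
  have "m * l + j - e + t = (m + k) * l + c - e"
    using kc assms(2) by (simp add: add_mult_distrib)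
  then have U: "U (m * l + j - e + t) = f c (U (m + k))"
    using parse[of c "m + k"] c assms(2) kc by (simp add: add_mult_distrib)
  have "f c (map U [m..<m + s] ! k) = f c (U (m + k))"
  proof (cases "k < s")
    case False
    then have "s * l \<le> k * l" by simp
    then have "c < lp" using kc t assms(1) by linarith
    then show ?thesis by (rule column_const)
  qed simp
  then show "inflate n j (map U [m..<m + s]) ! t = map U [m * l + j - e..<m * l + j - e + n] ! t"
    using t U by (simp add: inflate_def flip: k_def c_def)
qed (simp add: inflate_def)

lemma inflate_rev:
  assumes "n + 2 * j = length v * l + lp"
  shows "inflate n j (rev v) = rev (inflate n j v)"
proof (rule nth_equalityI)
  fix t assume "t < length (inflate n j (rev v))"
  then have t: "t < n" by (simp add: inflate_def)
  define k c where "k = (j + t) div l" and "c = (j + t) mod l"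
  have c: "c < l" and kc: "j + t = k * l + c"
    unfolding k_def c_def using l_pos by simp_all
  define s where "s = length v"
  have refl: "j + (n - Suc t) + k * l + c + 1 = s * l + lp"
    using assms t kc unfolding s_def by linarith
  have "f c (rev v ! k) = f ((j + (n - Suc t)) mod l) (v ! ((j + (n - Suc t)) div l))"
  proof (cases "c < lp")
    case True
    have "k \<le> s"
    proof (rule ccontr)
      assume "\<not> k \<le> s"
      then have "Suc s * l \<le> k * l" by (intro mult_le_mono1) simp
      then show False using refl lp_less by simp
    qed
    then obtain d where d: "s = k + d" using le_Suc_ex by blast
    define c' where c': "c' = lp - 1 - c"
    have "j + (n - Suc t) = d * l + c'"
      using refl True d c' by (simp add: add_mult_distrib)
    moreover have "c' < l" using lp_less c' by linarith
    ultimately have "(j + (n - Suc t)) mod l = lp - 1 - c" using c' by simp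
    then show ?thesis using True column_reflect_p column_const by metis
  next
    case False
    have "k < s"
    proof (rule ccontr)
      assume "\<not> k < s"
      then have "s * l \<le> k * l" by (intro mult_le_mono1) simp
      then show False using refl False by linarith
    qed
    then obtain d where d: "s = Suc (k + d)" using less_imp_Suc_add by blast
    have "j + (n - Suc t) = d * l + (l + lp - 1 - c)"
      using refl False c d by (simp add: add_mult_distrib)
    moreover have "l + lp - 1 - c < l" using False c by linarith
    ultimately have "(j + (n - Suc t)) mod l = l + lp - 1 - c" "(j + (n - Suc t)) div l = d"
      by simp_all
    moreover have "rev v ! k = v ! d"
      using d by (simp add: rev_nth flip: s_def)
    ultimately show ?thesis using False c column_reflect_q[of c] by simp
  qed
  then show "inflate n j (rev v) ! t = rev (inflate n j v) ! t"
    using t by (simp add: inflate_def rev_nth flip: k_def c_def)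
qed (simp add: inflate_def)

text \<open>
  At most \<open>l - 1\<close> letters are removed from either end. So the last letter of the first block survives,
  and it determines the first letter of \<open>v\<close>; in every later block the first letter after
  \<open>p\<close> survives, even in the last one, because the closing \<open>p\<close> absorbs part of the trimming.
\<close>
lemma inflate_inj:
  assumes len: "length v = s" "length v' = s" and s: "2 \<le> s"
    and n: "n + 2 * j = s * l + lp" and j: "j < l"
    and eq: "inflate n j v = inflate n j v'"
  shows "v = v'"
proof (rule nth_equalityI)
  fix k assume "k < length v"
  then have k: "k < s" using len by simp
  have same: "f c (v ! k) = f c (v' ! k)" if "c < l" "j \<le> k * l + c" "k * l + c < j + n" for c
  proof -
    have "k * l + c - j < n" using that by simp
    then have "f ((k * l + c) mod l) (v ! ((k * l + c) div l))
        = f ((k * l + c) mod l) (v' ! ((k * l + c) div l))"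
      using arg_cong[OF eq, of "\<lambda>w. w ! (k * l + c - j)"] that(2) by (simp add: inflate_def)
    then show ?thesis using that(1) by simp
  qed
  show "v ! k = v' ! k"
  proof (cases k)
    case 0
    have "2 * l \<le> s * l" using s by (rule mult_le_mono1)
    then have "k * l + (l - 1) < j + n" "j \<le> k * l + (l - 1)" "l - 1 < l"
      unfolding 0 mult_0 add_0 using j n by linarith+
    then have "f (l - 1) (v ! k) = f (l - 1) (v' ! k)"
      by (intro same)
    then show ?thesis using inj_last by (simp add: inj_eq)
  next
    case (Suc k')
    have "Suc k * l \<le> s * l" using k by (intro mult_le_mono1) simp
    then have "f lp (v ! k) = f lp (v' ! k)"
      using Suc j n lp_less by (intro same) simp_all
    then show ?thesis using inj_first by (simp add: inj_eq)
  qed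
qed (use len in simp)

text \<open>
  Used to move a factor away from the possibly incomplete block with index \<open>0\<close>.
\<close>
lemma window_recurs: "\<exists>m'\<ge>1. map U [m..<m + s] = map U [m'..<m' + s]"
proof -
  obtain i where i: "i \<ge> 1" "\<And>j. j < m + s \<Longrightarrow> U (i + j) = U j"
    using recurrent[of "m + s"] by blast
  have "map U [m..<m + s] = map U [i + m..<i + m + s]"
    by (rule nth_equalityI) (auto simp: i(2) add.assoc)
  then show ?thesis using i(1) by (intro exI[of _ "i + m"]) simp
qed

lemma inflate_occurs:
  assumes "n + 2 * j = s * l + lp" "j < l"
  obtains m where "inflate n j (map U [i..<i + s]) = map U [m * l + j - e..<m * l + j - e + n]"
    "e \<le> m * l + j"
proof -
  obtain m where m: "m \<ge> 1" "map U [i..<i + s] = map U [m..<m + s]"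
    using window_recurs by blast
  have "1 * l \<le> m * l" using m(1) by (rule mult_le_mono1)
  then have "e \<le> m * l + j" using e_le lp_less by linarith
  then show ?thesis using that inflate_window[OF assms(1), of m] m(2) by simp
qed

text \<open>
  The pairs \<open>(s, v)\<close> correspond bijectively to the palindromes of length \<open>n\<close>. The phase of an occurrence
  gives back the number \<open>j\<close> of removed letters, hence \<open>s\<close>, and then \<open>inflate_inj\<close> gives back
  \<open>v\<close>. Conversely, the blocks that meet a given palindrome \<open>w\<close> of length \<open>n\<close> come from a factor \<open>v\<close>;
  since \<open>w\<close> is in phase with its reversal, it is obtained by trimming both ends equally. Both \<open>v\<close> and its
  reversal then inflate to \<open>w\<close>, so \<open>v\<close> is a palindrome.
\<close>
lemma card_pal_factors_acyclic:
  assumes "\<not> cyclic"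
  shows "\<exists>n0>0. \<forall>n\<ge>n0. card (pal_factors U n) = (\<Sum>k\<in>\<E> l lp n. card (pal_factors U k))"
proof -
  obtain L1 where L1: "\<And>a b. (\<And>t. t < L1 \<Longrightarrow> U (a + t) = U (b + t)) \<Longrightarrow> (a + e) mod l = (b + e) mod l"
    using occurrences_in_phase[OF assms] by metis
  obtain L2 where L2: "\<And>a n. n \<ge> L2 \<Longrightarrow> palindrome (map U [a..<a + n]) \<Longrightarrow>
      int l dvd 2 * (int a + int e) + int n - int lp"
    using palindromes_in_phase[OF assms] by blast
  \<comment> \<open>the summand \<open>l + lp + 1\<close> ensures \<open>s \<ge> 2\<close>, as \<open>inflate_inj\<close> requires\<close>
  define n0 where "n0 = L1 + L2 + l + lp + 1"
  have "card (pal_factors U n) = (\<Sum>k\<in>\<E> l lp n. card (pal_factors U k))" if n: "n \<ge> n0" for n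
  proof -
    define trim where "trim = (\<lambda>s. (s * l + lp - n) div 2)"
    have trimI: "trim s = j" if "n + 2 * j = s * l + lp" for s j
      unfolding trim_def using that[symmetric] by simp
    have trim: "n + 2 * trim s = s * l + lp" "trim s < l" "2 \<le> s" if s: "s \<in> \<E> l lp n" for s
    proof -
      obtain j where j: "j < l" "n + 2 * j = s * l + lp"
        using s scales_iff[OF l_pos] by blast
      then show "n + 2 * trim s = s * l + lp" "trim s < l" using trimI by simp_all
      show "2 \<le> s"
      proof (rule ccontr)
        assume "\<not> 2 \<le> s"
        then have "s * l \<le> 1 * l" by (intro mult_le_mono1) simp
        then show False using j n unfolding n0_def by linarith
      qed
    qed
    let ?\<Phi> = "\<lambda>(s, v). inflate n (trim s) v"
    let ?P = "SIGMA s:\<E> l lp n. pal_factors U s"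
    have "inj_on ?\<Phi> ?P"
    proof (rule inj_onI)
      fix x x' assume x: "x \<in> ?P" and x': "x' \<in> ?P" and eq: "?\<Phi> x = ?\<Phi> x'"
      obtain s i v where sv: "x = (s, v)" "s \<in> \<E> l lp n" "v = map U [i..<i + s]"
        using x by (auto simp: pal_factors_def)
      obtain s' i' v' where sv': "x' = (s', v')" "s' \<in> \<E> l lp n" "v' = map U [i'..<i' + s']"
        using x' by (auto simp: pal_factors_def)
      note T = trim[OF sv(2)] and T' = trim[OF sv'(2)]
      obtain m where m: "inflate n (trim s) v
          = map U [m * l + trim s - e..<m * l + trim s - e + n]" "e \<le> m * l + trim s"
        using inflate_occurs[OF T(1,2)] unfolding sv(3) by blast
      obtain m' where m': "inflate n (trim s') v'
          = map U [m' * l + trim s' - e..<m' * l + trim s' - e + n]" "e \<le> m' * l + trim s'"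
        using inflate_occurs[OF T'(1,2)] unfolding sv'(3) by blast
      have win: "map U [m * l + trim s - e..<m * l + trim s - e + n]
          = map U [m' * l + trim s' - e..<m' * l + trim s' - e + n]"
        using eq m(1) m'(1) sv(1) sv'(1) by simp
      have "(m * l + trim s - e + e) mod l = (m' * l + trim s' - e + e) mod l"
      proof (rule L1)
        fix t assume "t < L1"
        then have "t < n" using n unfolding n0_def by simp
        then show "U (m * l + trim s - e + t) = U (m' * l + trim s' - e + t)"
          using arg_cong[OF win, of "\<lambda>w. w ! t"] by simp
      qed
      then have "trim s = trim s'" using m(2) m'(2) T(2) T'(2) by simp
      then have "s * l = s' * l" using T(1) T'(1) by linarith
      then have ss: "s = s'" using l_pos by simp
      have "inflate n (trim s) v = inflate n (trim s) v'" using eq ss sv(1) sv'(1) by simp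
      then have "v = v'"
        using inflate_inj[of v s v' n "trim s"] T sv(3) sv'(3) ss by simp
      then show "x = x'" using ss sv(1) sv'(1) by simp
    qed
    moreover have "?\<Phi> ` ?P = pal_factors U n"
    proof (intro equalityI subsetI)
      fix w assume "w \<in> ?\<Phi> ` ?P"
      then obtain s i v where sv: "w = inflate n (trim s) v" "s \<in> \<E> l lp n"
          "v = map U [i..<i + s]" "palindrome v"
        by (auto simp: pal_factors_def)
      note T = trim[OF sv(2)]
      have "rev w = w"
        using inflate_rev[of n "trim s" v] T(1) sv unfolding palindrome_def by simp
      moreover obtain m where "w = map U [m * l + trim s - e..<m * l + trim s - e + n]"
        using inflate_occurs[OF T(1,2)] unfolding sv(1,3) by blast
      ultimately show "w \<in> pal_factors U n"
        unfolding pal_factors_def palindrome_def by blast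
    next
      fix w assume "w \<in> pal_factors U n"
      then obtain a where a: "w = map U [a..<a + n]" "palindrome w"
        by (auto simp: pal_factors_def)
      define m j where "m = (a + e) div l" and "j = (a + e) mod l"
      have j: "j < l" and mj: "a + e = m * l + j"
        unfolding m_def j_def using l_pos by simp_all
      have mj': "int a + int e = int m * int l + int j"
        using arg_cong[OF mj, of int] by simp
      have "int l dvd 2 * (int a + int e) + int n - int lp"
        using L2[of n a] a n unfolding n0_def by simp
      then have "int l dvd (2 * int j + int n - int lp) + 2 * int m * int l"
        unfolding mj' by (simp add: algebra_simps)
      then have "int l dvd 2 * int j + int n - int lp"
        by (simp add: dvd_add_left_iff)
      then have "int l dvd int (n + 2 * j - lp)"
        using n unfolding n0_def by (simp add: of_nat_diff algebra_simps)
      then have "l dvd n + 2 * j - lp" by (simp only: int_dvd_int_iff)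
      then obtain s where s: "n + 2 * j - lp = l * s" by (rule dvdE)
      then have ns: "n + 2 * j = s * l + lp"
        using n unfolding n0_def by (simp add: mult.commute)
      have "s > 0"
        using ns n unfolding n0_def by (cases s) auto
      then have sE: "s \<in> \<E> l lp n" using scales_iff[OF l_pos] ns j by blast
      have tj: "trim s = j" using trimI ns by blast
      define v where "v = map U [m..<m + s]"
      have w: "inflate n j v = w"
        using inflate_window[OF ns, of m] mj a(1) unfolding v_def by (metis add_diff_cancel_right' le_add2)
      have "inflate n j (rev v) = inflate n j v"
        using inflate_rev[of n j v] ns w a(2) unfolding palindrome_def by (simp add: v_def)
      then have "rev v = v"
        using inflate_inj[of "rev v" s v n j] trim(3)[OF sE] ns j by (simp add: v_def)
      then have "(s, v) \<in> ?P" using sE unfolding pal_factors_def palindrome_def v_def by blast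
      then show "w \<in> ?\<Phi> ` ?P" using w tj by force
    qed
    ultimately have "card ?P = card (pal_factors U n)"
      by (metis card_image)
    then show ?thesis
      by (simp add: card_SigmaI finite_scales l_pos finite_pal_factors)
  qed
  moreover have "n0 > 0" by (simp add: n0_def)
  ultimately show ?thesis by blast
qed

section \<open>Cyclic sequences\<close>

text \<open>
  The predecessor function \<open>G\<close> is onto, hence a permutation of the finite alphabet, so an equality of
  two letters propagates in both directions.
\<close>
lemma cyclic_shift:
  assumes cyclic "U t = U (t + k)"
  shows "U t' = U (t' + k)"
proof -
  obtain G where G: "\<And>t. U t = G (U (Suc t))" using assms(1) unfolding cyclic_def by blast
  have "surj G"
  proof -
    have "\<exists>b. a = G b" for a
    proof -
      have "a \<in> range U" using all_letters by simp
      then obtain t where "a = U t" by blast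
      then show ?thesis using G by blast
    qed
    then show ?thesis by (auto simp: surj_def)
  qed
  then have "inj G" by (simp add: finite_UNIV_surj_inj)
  then have step: "U i = U (i + k) \<longleftrightarrow> U (Suc i) = U (Suc i + k)" for i
    using G[of i] G[of "i + k"] by (metis add_Suc inj_eq)
  have "U i = U (i + k) \<longleftrightarrow> U 0 = U (0 + k)" for i
  proof (induction i)
    case (Suc i)
    then show ?case using step[of i] by simp
  qed simp
  then show ?thesis using assms(2) by blast
qed

lemma palindrome_center:
  assumes "palindrome (map U [i..<i + n])"
  shows "even n \<Longrightarrow> n \<ge> 2 \<Longrightarrow> \<exists>t. U t = U (t + 1)"
    and "odd n \<Longrightarrow> n \<ge> 2 \<Longrightarrow> \<exists>t. U t = U (t + 2)"
proof -
  have sym: "U (i + t) = U (i + (n - 1 - t))" if "t < n" for t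
    using assms that unfolding palindrome_window_iff by blast
  {
    assume "even n" "n \<ge> 2"
    then obtain h where h: "n = 2 * h" "h \<ge> 1" by auto
    have "n - 1 - (h - 1) = h" using h by simp
    then have "U (i + (h - 1)) = U (i + (h - 1) + 1)"
      using sym[of "h - 1"] h by simp
    then show "\<exists>t. U t = U (t + 1)" by blast
  next
    assume "odd n" "n \<ge> 2"
    then obtain h where h: "n = 2 * h + 1" "h \<ge> 1" by (auto elim!: oddE)
    have "n - 1 - (h - 1) = h + 1" using h by simp
    then have "U (i + (h - 1)) = U (i + (h - 1) + 2)"
      using sym[of "h - 1"] h by simp
    then show "\<exists>t. U t = U (t + 2)" by blast
  }
qed

text \<open>
  A palindrome of length at least \<open>2\<close> has a factor \<open>aa\<close> or \<open>aba\<close> at its centre. By \<open>cyclic_shift\<close>,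
  \<open>aa\<close> would make \<open>U\<close> constant, and \<open>aba\<close> makes it alternate between two letters. In the alternating
  case all factors of odd length are palindromes, two for each length.
\<close>
lemma card_pal_factors_cyclic:
  assumes cyc: cyclic and two: "card (UNIV :: 'a set) \<ge> 2"
  shows "\<exists>n0>0. \<forall>n\<ge>n0. card (pal_factors U n) = (\<Sum>k\<in>\<E> l lp n. card (pal_factors U k))"
proof -
  have ne1: "U t \<noteq> U (t + 1)" for t
  proof
    assume "U t = U (t + 1)"
    then have "U i = U (Suc i)" for i using cyclic_shift[OF cyc, of t 1 i] by simp
    then have "U i = U 0" for i by (induction i) simp_all
    then have "range U = {U 0}" by force
    then have "card (range U) = 1" by simp
    then have "card (UNIV :: 'a set) = 1" unfolding all_letters .
    then show False using two by simp
  qed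
  have even0: "card (pal_factors U n) = 0" if "even n" "n \<ge> 2" for n
  proof -
    have "pal_factors U n = {}"
      using palindrome_center(1) that ne1 unfolding pal_factors_def by blast
    then show ?thesis by simp
  qed
  show ?thesis
  proof (cases "\<exists>t. U t = U (t + 2)")
    case False
    have zero: "card (pal_factors U n) = 0" if "n \<ge> 2" for n
    proof -
      have "pal_factors U n = {}"
        using palindrome_center that ne1 False unfolding pal_factors_def by blast
      then show ?thesis by simp
    qed
    have "card (pal_factors U n) = (\<Sum>k\<in>\<E> l lp n. card (pal_factors U k))" if n: "n \<ge> l + lp + 2" for n
    proof -
      have "k \<ge> 2" if k: "k \<in> \<E> l lp n" for k
      proof (rule ccontr)
        assume "\<not> 2 \<le> k"
        then have "k * l \<le> 1 * l" by (intro mult_le_mono1) simp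
        moreover obtain j where "n + 2 * j = k * l + lp" using k scales_iff[OF l_pos] by blast
        ultimately show False using n by linarith
      qed
      then show ?thesis using zero n by simp
    qed
    then show ?thesis by (intro exI[of _ "l + lp + 2"]) simp
  next
    case True
    have per: "U t = U (t + 2)" for t using True cyclic_shift[OF cyc] by blast
    have par: "U i = U j \<longleftrightarrow> even (i + j)" for i j
    proof -
      have U01: "U i = (if even i then U 0 else U 1)" for i
      proof (induction i rule: less_induct)
        case (less i)
        show ?case
        proof (cases "i < 2")
          case True
          then show ?thesis by (auto simp: less_2_cases_iff)
        next
          case False
          then obtain i' where i': "i = i' + 2" by (metis add.commute le_Suc_ex not_less)
          then show ?thesis using less[of i'] per[of i'] by simp
        qed
      qed
      have "U 0 \<noteq> U 1" using ne1[of 0] by simp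
      then show ?thesis unfolding U01[of i] U01[of j] by (cases "even i"; cases "even j") simp_all
    qed
    \<comment> \<open>for even \<open>l\<close> the blocks of \<open>U 1\<close> and \<open>U 2\<close> would agree in column \<open>lp\<close>\<close>
    have oddl: "odd l"
    proof
      assume "even l"
      then have "U (1 * l + lp - e) = U (2 * l + lp - e)"
        using e_le lp_less by (subst par) (simp add: algebra_simps)
      moreover have "U (1 * l + lp - e) = f lp (U 1)" "U (2 * l + lp - e) = f lp (U 2)"
        using parse[of lp 1] parse[of lp 2] e_le lp_less by simp_all
      ultimately show False using inj_first ne1[of 1] by (simp add: inj_eq numeral_2_eq_2)
    qed
    \<comment> \<open>for odd \<open>l\<close> consecutive blocks begin with different letters\<close>
    have lp0: "lp = 0"
    proof (rule ccontr)
      assume "lp \<noteq> 0"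
      then have "f 0 (U 1) = f 0 (U 2)" using column_const by simp
      moreover have "U (1 * l + 0 - e) = f 0 (U 1)" "U (2 * l + 0 - e) = f 0 (U 2)"
        using parse[of 0 1] parse[of 0 2] e_le lp_less by simp_all
      ultimately have "U (l - e) = U (2 * l - e)" by simp
      then have "even (l - e + (2 * l - e))" by (simp only: par)
      then show False using oddl e_le lp_less by (simp add: algebra_simps)
    qed
    have odd2: "card (pal_factors U n) = 2" if "odd n" for n
    proof -
      have eqw: "map U [i..<i + n] = map U [i'..<i' + n] \<longleftrightarrow> even (i + i')" for i i'
      proof -
        have "n > 0" using that by (cases n) auto
        then show ?thesis by (auto simp: list_eq_iff_nth_eq par)
      qed
      have "palindrome (map U [i..<i + n])" for i
        unfolding palindrome_window_iff par using that by auto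
      then have "pal_factors U n = range (\<lambda>i. map U [i..<i + n])"
        unfolding pal_factors_def by auto
      also have "\<dots> = {map U [0..<0 + n], map U [1..<1 + n]}"
      proof -
        have "map U [i..<i + n] \<in> {map U [0..<0 + n], map U [1..<1 + n]}" for i
          unfolding insert_iff eqw by auto
        then show ?thesis by blast
      qed
      finally show ?thesis using eqw[of 0 1] by simp
    qed
    have "card (pal_factors U n) = (\<Sum>k\<in>\<E> l lp n. card (pal_factors U k))" if n: "n \<ge> 2 * l + 2" for n
    proof -
      have "card (pal_factors U k) = card (pal_factors U n)" if k: "k \<in> \<E> l lp n" for k
      proof -
        obtain j where j: "n + 2 * j = k * l" using k scales_iff[OF l_pos] lp0 by auto
        have "k \<ge> 2"
        proof (rule ccontr)
          assume "\<not> 2 \<le> k"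
          then have "k * l \<le> 1 * l" by (intro mult_le_mono1) simp
          then show False using n j by linarith
        qed
        moreover have "even k \<longleftrightarrow> even n" using arg_cong[OF j, of even] oddl by simp
        ultimately show ?thesis using even0 odd2 n by (cases "even n") simp_all
      qed
      then show ?thesis using card_scales_odd[OF oddl, of lp n] n lp0 by simp
    qed
    then show ?thesis by (intro exI[of _ "2 * l + 2"]) simp
  qed
qed

end

section \<open>Palindromic complexity of fixed points in class P\<close>

theorem theorem9:
  fixes \<sigma> :: "'a::finite \<Rightarrow> 'a list"
    and u :: "'a stream"
    and p :: "'a list"
    and q :: "'a \<Rightarrow> 'a list"
    and lp lq l :: nat
  assumes "primitive_morphism \<sigma>"
    and "morph_stream \<sigma> u = u"
    and "palindrome p"
    and "\<And>a. palindrome (q a)"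
    and "(\<forall>a. \<sigma> a = p @ q a) \<or> (\<forall>a. \<sigma> a = q a @ p)"
    and "uniform_morphism \<sigma>"
    and "lp = length p"
    and "\<And>a. lq = length (q a)"
    and "l = lp + lq"
    and "\<And>a b. a \<noteq> b \<Longrightarrow> q a \<noteq> [] \<and> q b \<noteq> [] \<and> hd (q a) \<noteq> hd (q b)"
    \<comment> \<open>over a one-letter alphabet the conclusion fails for every even \<open>l\<close>\<close>
    and "card (UNIV :: 'a set) \<ge> 2 \<or> odd l"
  shows "\<exists>n0>0. \<forall>n\<ge>n0. pal u n = (\<Sum>k\<in>\<E> l lp n. pal u k)"
proof (cases "card (UNIV :: 'a set) \<ge> 2")
  case False
  have "card (UNIV :: 'a set) > 0" by (simp add: card_gt_0_iff)
  then have "card (UNIV :: 'a set) = 1" using False by linarith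
  then obtain z where z: "(UNIV :: 'a set) = {z}" by (auto simp: card_1_singleton_iff)
  have one: "card (pal_factors (snth u) n) = 1" for n
  proof -
    have const: "x = y" for x y :: 'a using z by (metis UNIV_I singletonD)
    have eq: "map (snth u) [i..<i + n] = map (snth u) [0..<0 + n]" for i
      by (rule nth_equalityI) (simp_all, rule const)
    have "palindrome (map (snth u) [0..<0 + n])"
      unfolding palindrome_window_iff using const by blast
    then have "pal_factors (snth u) n = {map (snth u) [0..<0 + n]}"
      unfolding pal_factors_def using eq by auto
    then show ?thesis by simp
  qed
  have "odd l" using assms(11) False by blast
  then have "\<forall>n\<ge>lp + 1. pal u n = (\<Sum>k\<in>\<E> l lp n. pal u k)"
    using card_scales_odd[of l lp] by (simp add: pal_eq_card one)
  then show ?thesis by (intro exI[of _ "lp + 1"]) simp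
next
  case two: True
  have len: "length (\<sigma> a) = l" for a
    using assms(5) assms(7,9) assms(8)[of a] by (metis add.commute length_append)
  obtain k where k: "k \<ge> 1" "\<And>a b. b \<in> set ((morph \<sigma> ^^ k) [a])"
    using assms(1) unfolding primitive_morphism_def by blast
  \<comment> \<open>a power of the morphism maps one letter to a word of length \<open>l ^ k\<close> containing all letters\<close>
  have l2: "l \<ge> 2"
  proof (rule ccontr)
    assume "\<not> l \<ge> 2"
    then have "l ^ k \<le> 1 ^ k" by (intro power_mono) simp_all
    then have "l ^ k \<le> 1" by simp
    moreover have "card (UNIV :: 'a set) \<le> l ^ k"
    proof -
      have "UNIV = set ((morph \<sigma> ^^ k) [undefined])" using k(2) by blast
      then have "card (UNIV :: 'a set) \<le> length ((morph \<sigma> ^^ k) [undefined])"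
        by (metis card_length)
      then show ?thesis using length_morph_pow[of \<sigma> l k "[undefined]", OF len] by simp
    qed
    ultimately show False using two by linarith
  qed
  then have l0: "l > 0" by simp
  have par: "u !! (m * l + j) = \<sigma> (u !! m) ! j" if "j < l" for m j
    using snth_fixed_point[OF len l0 that assms(2)] .
  have other: "\<exists>b. b \<noteq> a" for a :: 'a
  proof (rule ccontr)
    assume "\<not> (\<exists>b. b \<noteq> a)"
    then have "UNIV = {a}" by auto
    then have "card (UNIV :: 'a set) = card {a}" by (rule arg_cong)
    then show False using two by simp
  qed
  have qne: "q a \<noteq> []" for a
    using other[of a] assms(10) by metis
  have lq0: "lq > 0" using assms(8)[of undefined] qne[of undefined] by simp
  define f where "f = (\<lambda>j a. (p @ q a) ! j)"
  have fp: "f j a = p ! j" if "j < lp" for j a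
    unfolding f_def using that assms(7) by (simp add: nth_append)
  have fq: "f j a = q a ! (j - lp)" if "lp \<le> j" for j a
    unfolding f_def using that assms(7) by (simp add: nth_append)
  have palp: "p ! (lp - 1 - j) = p ! j" if "j < lp" for j
    using assms(3,7) that unfolding palindrome_def by (metis diff_Suc_eq_diff_pred rev_nth)
  have palq: "q a ! (lq - 1 - j) = q a ! j" if "j < lq" for j a
    using assms(4)[of a] assms(8)[of a] that unfolding palindrome_def
    by (metis diff_Suc_eq_diff_pred rev_nth)
  obtain e where e: "e \<le> lp"
    "\<And>m j. j < l \<Longrightarrow> e \<le> m * l + j \<Longrightarrow> u !! (m * l + j - e) = f j (u !! m)"
  proof (cases "\<forall>a. \<sigma> a = p @ q a")
    case True
    show ?thesis
      by (rule that[of 0]) (use par True in \<open>simp_all add: f_def\<close>)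
  next
    case False
    then have qp: "\<sigma> a = q a @ p" for a using assms(5) by blast
    \<comment> \<open>here \<open>u\<close> is \<open>q p q p \<dots>\<close>; a block \<open>p q\<close> consists of the \<open>p\<close> that ends one image and the \<open>q\<close> of the next\<close>
    have "u !! (m * l + j - lp) = f j (u !! m)" if j: "j < l" "lp \<le> m * l + j" for m j
    proof (cases "lp \<le> j")
      case True
      then have "m * l + j - lp = m * l + (j - lp)" by simp
      moreover have "j - lp < length (q (u !! m))" using True j assms(8)[of "u !! m"] assms(9) by linarith
      ultimately show ?thesis
        using par[of "j - lp" m] True j by (simp add: qp fq nth_append)
    next
      case False
      then obtain m' where m': "m = Suc m'" using j by (cases m) auto
      have "m * l + j - lp = m' * l + (lq + j)" using assms(9) m' by simp
      then show ?thesis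
        using par[of "lq + j" m'] False assms(8)[of "u !! m'"] assms(9)
        by (simp add: qp fp nth_append)
    qed
    then show ?thesis using that[of lp] by simp
  qed
  interpret marked_sequence "snth u" f l lp e
  proof
    show "lp < l" using lq0 assms(9) by simp
    show "e \<le> lp" by (rule e(1))
    show "u !! (m * l + j - e) = f j (u !! m)" if "j < l" "e \<le> m * l + j" for m j
      using e(2) that .
    show "f j a = f j b" if "j < lp" for j a b using fp that by simp
    show "f (lp - 1 - j) a = f j a" if "j < lp" for j a
      using fp[of j] fp[of "lp - 1 - j"] palp that by simp
    show "f (l + lp - 1 - j) a = f j a" if "lp \<le> j" "j < l" for j a
    proof -
      have "f (l + lp - 1 - j) a = q a ! (lq - 1 - (j - lp))"
        using fq[of "l + lp - 1 - j" a] that assms(9) by simp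
      then show ?thesis using palq[of "j - lp" a] fq[of j a] that assms(9) by simp
    qed
    show "inj (f (l - 1))"
    proof (rule injI)
      fix a b assume eq: "f (l - 1) a = f (l - 1) b"
      have "f (l - 1) c = hd (q c)" for c
        using fq[of "l - 1" c] palq[of 0 c] lq0 assms(9) qne[of c] by (simp add: hd_conv_nth)
      then show "a = b" using eq assms(10) by metis
    qed
    show "\<exists>K. \<forall>T. \<exists>i\<ge>T. i + N \<le> T + K \<and> (\<forall>j<N. u !! (i + j) = u !! j)" for N
      by (rule prefix_uniformly_recurrent[OF len l2 _ assms(1)]) (rule par)
    show "range (snth u) = UNIV"
    proof -
      have "b \<in> range (snth u)" for b
        using k(2)[of b "u !! 0"] morph_pow_window[of \<sigma> l "snth u" k 0 1, OF len l0 par] by auto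
      then show ?thesis by blast
    qed
  qed
  show ?thesis
    unfolding pal_eq_card using card_pal_factors_acyclic card_pal_factors_cyclic[OF _ two] by blast
qed

end
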